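(* For every $\beta>0$ there is a constant $C_\beta$ depending only on $\beta$ such that the following holds. Let $N\ge1$, let $\boldsymbol{\xi}$ be a random subset of $\{1,\dots,N\}$ distributed according to a non-trivial product distribution with $\beta\le\min\{p_k,1-p_k\}$ for all $k$, let $\kappa\in(0,1]$, and let $\mathcal{A}\subset2^{\{1,\dots,N\}}$ be a $\kappa$-Sperner family. Then $$\mathbb{P}[\boldsymbol{\xi}\in\mathcal{A}]\le\frac{C_\beta}{\kappa\sqrt N}.$$
   Context: Subsets $\boldsymbol{\xi}\subset\{1,\dots,N\}$ are identified with vectors $(\xi_1,\dots,\xi_N)\in\{0,1\}^N$ via $\xi_k=1$ iff $k\in\boldsymbol{\xi}$. A probability measure on $2^{\{1,\dots,N\}}$ is a product distribution if the coordinates $\xi_k$ are independent; it is non-trivial if $p_k:=\mathbb{P}[\xi_k=1]\in(0,1)$ for all $k$. $\mathcal{A}\subset2^{\{1,\dots,N\}}$ is a $\kappa$-Sperner family ($\kappa\in(0,1]$) if for every $\boldsymbol{\eta}\in\mathcal{A}$ there is $B(\boldsymbol{\eta})\subset\boldsymbol{\eta}^c$ with $|B(\boldsymbol{\eta})|\ge\kappa|\boldsymbol{\eta}^c|$ such that for any $\boldsymbol{\eta}'\in\mathcal{A}$, $\boldsymbol{\eta}'\supset\boldsymbol{\eta}$ implies $\boldsymbol{\eta}'\cap B(\boldsymbol{\eta})=\varnothing$. *)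

theory Defs
  imports "HOL-Probability.Probability"
begin

definition coord :: "nat \<Rightarrow> nat set \<Rightarrow> nat" where
  "coord k \<xi> = (if k \<in> \<xi> then 1 else 0)"

definition product_distribution :: "nat \<Rightarrow> nat set measure \<Rightarrow> bool" where
  "product_distribution N \<mu> \<longleftrightarrow>
     prob_space \<mu> \<and>
     space \<mu> = Pow {1..N} \<and>
     sets \<mu> = Pow (Pow {1..N}) \<and>
     prob_space.indep_vars \<mu> (\<lambda>_. count_space UNIV) coord {1..N}"

definition marginal :: "nat set measure \<Rightarrow> nat \<Rightarrow> real" where
  "marginal \<mu> k = measure \<mu> {\<xi> \<in> space \<mu>. coord k \<xi> = 1}"

definition nontrivial_distribution :: "nat \<Rightarrow> nat set measure \<Rightarrow> bool" where
  "nontrivial_distribution N \<mu> \<longleftrightarrow> (\<forall>k\<in>{1..N}. marginal \<mu> k \<in> {0<..<1})"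

(* The range 0 < \<kappa> \<le> 1 is not part of the definition; it is assumed where the notion is used. *)
definition sperner_family :: "real \<Rightarrow> nat \<Rightarrow> nat set set \<Rightarrow> bool" where
  "sperner_family \<kappa> N \<A> \<longleftrightarrow>
     \<A> \<subseteq> Pow {1..N} \<and>
     (\<forall>\<eta>\<in>\<A>. \<exists>B. B \<subseteq> {1..N} - \<eta> \<and>
        real (card B) \<ge> \<kappa> * real (card ({1..N} - \<eta>)) \<and>
        (\<forall>\<eta>'\<in>\<A>. \<eta> \<subseteq> \<eta>' \<longrightarrow> \<eta>' \<inter> B = {}))"

end

theory Submission
  imports Defs
begin

text \<open>A product-distributed \<open>\<xi>\<close> has the law of \<open>T \<union> U\<close>, where \<open>T\<close> is again product-distributed and,
  given \<open>T\<close>, every element outside \<open>T\<close> belongs to \<open>U\<close> independently with the same probability \<open>\<beta>\<close>.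
  So, given \<open>T\<close>, the set \<open>\<xi>\<close> is a uniformly random maximal chain started from \<open>T\<close> and stopped after an
  independent binomial number of steps. Such a chain meets a \<open>\<kappa>\<close>-Sperner family at most \<open>1 / \<kappa>\<close> times on
  average, and each value of the binomial variable has probability \<open>O(1 / \<surd>n)\<close>, where \<open>n\<close>, the number of
  elements outside \<open>T\<close>, is typically of order \<open>N\<close>.\<close>

section \<open>Weights of the binomial distribution\<close>

lemma Bernstein_variance:
  "(\<Sum>k\<le>n. (real n * x - real k)\<^sup>2 * Bernstein n k x) = real n * x * (1 - x)"
proof -
  have "(real n * x - real k)\<^sup>2 * Bernstein n k x =
      (real n * x)\<^sup>2 * Bernstein n k x + (1 - 2 * real n * x) * (real k * Bernstein n k x)
      + real k * (real k - 1) * Bernstein n k x" for k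
    by (simp add: power2_eq_square algebra_simps)
  then have "(\<Sum>k\<le>n. (real n * x - real k)\<^sup>2 * Bernstein n k x) =
      (real n * x)\<^sup>2 * (\<Sum>k\<le>n. Bernstein n k x)
      + (1 - 2 * real n * x) * (\<Sum>k\<le>n. real k * Bernstein n k x)
      + (\<Sum>k\<le>n. real k * (real k - 1) * Bernstein n k x)"
    by (simp only: sum.distrib sum_distrib_left)
  also have "\<dots> = real n * x * (1 - x)"
    unfolding sum_k_Bernstein sum_kk_Bernstein sum_Bernstein
    by (simp add: power2_eq_square algebra_simps)
  finally show ?thesis .
qed

text \<open>Up to normalisation, both weights on the right are multiples of the weight on the left:
  \<open>x * Suc n * Bernstein n k x\<close> is \<open>Suc k\<close> times it, and for
  \<open>k \<le> n\<close> the number \<open>(1 - x) * Suc n * Bernstein n (Suc k) x\<close> is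
  \<open>n - k\<close> times it.\<close>

lemma Bernstein_difference:
  "(real (Suc n) * x - real (Suc k)) * Bernstein (Suc n) (Suc k) x =
     real (Suc n) * x * (1 - x) * (Bernstein n (Suc k) x - Bernstein n k x)"
\<comment> \<open>For \<open>k < n\<close> all exponents are true differences, expressed through
  \<open>m\<close>. Otherwise truncated subtraction interferes, but then
  \<open>n choose Suc k\<close> vanishes.\<close>
proof (cases "k < n")
  case True
  then obtain m where n: "n = Suc (k + m)"
    using less_imp_Suc_add by auto
  have c1: "real (Suc k) * real (Suc n choose Suc k) = real (Suc n) * real (n choose k)"
    by (metis of_nat_mult Suc_times_binomial)
  have c2: "real (Suc m) * real (Suc n choose Suc k) = real (Suc n) * real (n choose Suc k)"
  proof -
    have "real (Suc n choose Suc k) = real (n choose k) + real (n choose Suc k)" by simp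
    then have "real (Suc m) * real (Suc n choose Suc k) =
        real (Suc n) * real (Suc n choose Suc k) - real (Suc k) * real (Suc n choose Suc k)"
      by (simp add: n algebra_simps)
    then show ?thesis using c1 by (simp add: algebra_simps)
  qed
  have "(real (Suc n) * x - real (Suc k)) * real (Suc n choose Suc k)
      = (x * (real (Suc m) * real (Suc n choose Suc k)) - (1 - x) * (real (Suc k) * real (Suc n choose Suc k)))"
    by (simp add: n algebra_simps)
  also have "\<dots> = real (Suc n) * (x * real (n choose Suc k) - (1 - x) * real (n choose k))"
    unfolding c1 c2 by (simp add: algebra_simps)
  finally have "(real (Suc n) * x - real (Suc k)) * real (Suc n choose Suc k) * (x ^ Suc k * (1 - x) ^ Suc m)
      = real (Suc n) * (x * real (n choose Suc k) - (1 - x) * real (n choose k)) * (x ^ Suc k * (1 - x) ^ Suc m)"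
    by simp
  moreover have "Suc n - Suc k = Suc m" "n - Suc k = m" "n - k = Suc m" using n by auto
  ultimately show ?thesis
    unfolding Bernstein_def by (simp only:) (simp add: algebra_simps del: binomial_Suc_Suc of_nat_Suc)
next
  case False
  then show ?thesis
    by (cases "k = n") (auto simp: Bernstein_def algebra_simps binomial_eq_0)
qed

text \<open>De Moivre's identity for the mean deviation: by \<open>Bernstein_difference\<close> the
  sum telescopes to a single weight.\<close>

lemma Bernstein_partial_sum:
  "(\<Sum>j\<le>k. (real (Suc n) * x - real j) * Bernstein (Suc n) j x) =
     real (Suc n) * x * (1 - x) * Bernstein n k x"
proof (induction k)
  case 0
  show ?case by (simp add: Bernstein_def)
next
  case (Suc k)
  then show ?case
    using Bernstein_difference[of n x k] by (simp add: algebra_simps del: of_nat_Suc)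
qed

text \<open>Telescoping bounds the binomial weight by the first absolute central moment of the binomial
  distribution, hence by its standard deviation.\<close>

lemma Bernstein_le_inverse_sqrt:
  assumes x: "0 < x" "x < 1" and k: "k \<le> n"
  shows "Bernstein n k x \<le> 1 / sqrt (real (Suc n) * x * (1 - x))"
proof -
  define s where "s = sqrt (real (Suc n) * x * (1 - x))"
  have s: "s > 0" and ss: "s * s = real (Suc n) * x * (1 - x)"
    using x by (auto simp: s_def)
  have B: "Bernstein m j x \<ge> 0" for m j
    using x by (simp add: Bernstein_nonneg)
  \<comment> \<open>Stands in for Cauchy-Schwarz. Here \<open>s\<close> is the standard deviation
    for \<open>Suc n\<close> trials, so under that binomial law both terms on the right average to
    \<open>s * s\<close>.\<close>
  have amgm: "2 * s * \<bar>t\<bar> \<le> t\<^sup>2 + s * s" for t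
    using zero_le_power2[of "\<bar>t\<bar> - s"] by (simp add: power2_diff) (simp add: power2_eq_square algebra_simps)
  have "2 * s * (s * s * Bernstein n k x) =
      (\<Sum>j\<le>k. 2 * s * ((real (Suc n) * x - real j) * Bernstein (Suc n) j x))"
    by (simp only: ss Bernstein_partial_sum flip: sum_distrib_left)
  also have "\<dots> \<le> (\<Sum>j\<le>k. ((real (Suc n) * x - real j)\<^sup>2 + s * s) * Bernstein (Suc n) j x)"
  proof (rule sum_mono)
    fix j
    have "2 * s * (real (Suc n) * x - real j) \<le> (real (Suc n) * x - real j)\<^sup>2 + s * s"
      using amgm[of "real (Suc n) * x - real j"] s
      by (smt (verit) mult_left_mono abs_ge_self)
    from mult_right_mono[OF this B]
    show "2 * s * ((real (Suc n) * x - real j) * Bernstein (Suc n) j x)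
        \<le> ((real (Suc n) * x - real j)\<^sup>2 + s * s) * Bernstein (Suc n) j x"
      by (simp add: mult.assoc)
  qed
  also have "\<dots> \<le> (\<Sum>j\<le>Suc n. ((real (Suc n) * x - real j)\<^sup>2 + s * s) * Bernstein (Suc n) j x)"
    using k B by (intro sum_mono2) auto
  also have "\<dots> = s * s + s * s"
    by (simp only: distrib_right sum.distrib Bernstein_variance sum_Bernstein ss mult_1_right
        flip: sum_distrib_left)
  finally have "(2 * s * s) * (s * Bernstein n k x) \<le> (2 * s * s) * 1"
    by (simp add: algebra_simps)
  then have "s * Bernstein n k x \<le> 1"
    using s by (simp only: mult_le_cancel_left_pos mult_pos_pos zero_less_numeral)
  then show ?thesis
    unfolding s_def[symmetric] using s by (simp add: field_simps)
qed

section \<open>Maximal chains and Sperner families\<close>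

text \<open>A uniformly random maximal chain in an \<open>m\<close>-set passes through a given
  \<open>j\<close>-set with probability \<open>1 / (m choose j)\<close>. Its first step must land in
  that set, and the rest is the same question with one element fewer.\<close>

lemma inverse_binomial_eq_average:
  assumes "0 < j" "j \<le> m"
  shows "1 / real (m choose j) = real j / real m * (1 / real ((m - 1) choose (j - 1)))"
proof -
  obtain i l where il: "j = Suc i" "m = Suc l"
    using assms by (metis Suc_pred' less_le_trans)
  have "real (Suc i) * real (Suc l choose Suc i) = real (Suc l) * real (l choose i)"
    by (metis of_nat_mult Suc_times_binomial)
  moreover have "real (Suc l choose Suc i) \<noteq> 0" "real (l choose i) \<noteq> 0"
    using assms il by (auto simp del: binomial_Suc_Suc)
  ultimately show ?thesis
    by (simp add: il field_simps del: binomial_Suc_Suc of_nat_Suc)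
qed

text \<open>The left-hand side is the expected number of members of the family met by a uniformly random
  maximal chain from \<open>\<eta>\<close> to \<open>S\<close>; after a member \<open>\<zeta>\<close>, the next step enters \<open>B \<zeta>\<close> with
  probability at least \<open>\<kappa>\<close>, and then no further member is met.\<close>

lemma LYM_kappa_sperner:
  fixes S :: "'a set" and \<kappa> :: real
  assumes S: "finite S" and \<kappa>: "0 < \<kappa>" "\<kappa> \<le> 1" and A: "\<A> \<subseteq> Pow S"
    and B: "\<And>\<zeta>. \<zeta> \<in> \<A> \<Longrightarrow> B \<zeta> \<subseteq> S - \<zeta>"
      "\<And>\<zeta>. \<zeta> \<in> \<A> \<Longrightarrow> \<kappa> * real (card (S - \<zeta>)) \<le> real (card (B \<zeta>))"
      "\<And>\<zeta> \<zeta>'. \<zeta> \<in> \<A> \<Longrightarrow> \<zeta>' \<in> \<A> \<Longrightarrow> \<zeta> \<subseteq> \<zeta>' \<Longrightarrow> \<zeta>' \<inter> B \<zeta> = {}"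
    and \<eta>: "\<eta> \<subseteq> S"
  shows "(\<Sum>\<zeta> | \<zeta> \<in> \<A> \<and> \<eta> \<subseteq> \<zeta>. 1 / real (card (S - \<eta>) choose card (\<zeta> - \<eta>))) \<le> 1 / \<kappa>"
    (is "?V \<eta> \<le> _")
  using \<eta>
proof (induction "card (S - \<eta>)" arbitrary: \<eta>)
  case 0
  then have "\<eta> = S" using S by auto
  then have "{\<zeta>. \<zeta> \<in> \<A> \<and> \<eta> \<subseteq> \<zeta>} \<subseteq> {S}" using A by auto
  then have "?V \<eta> \<le> (\<Sum>\<zeta>\<in>{S}. 1 / real (card (S - \<eta>) choose card (\<zeta> - \<eta>)))"
    by (intro sum_mono2) auto
  also have "\<dots> \<le> 1 / \<kappa>" using \<kappa> \<open>\<eta> = S\<close> by simp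
  finally show ?case .
next
  case (Suc m)
  have finA: "finite \<A>" using A S by (meson finite_Pow_iff finite_subset)
  have m: "card (S - \<eta>) = Suc m" using Suc by simp
  have fin: "finite (S - \<eta>)" using S by simp
  have IH: "?V (insert k \<eta>) \<le> 1 / \<kappa>" if "k \<in> S - \<eta>" for k
  proof (rule Suc.hyps(1))
    have "S - insert k \<eta> = S - \<eta> - {k}" by blast
    then show "m = card (S - insert k \<eta>)"
      using that m by (metis card_Diff_singleton diff_Suc_1)
  qed (use that Suc.prems in auto)
  define f where "f \<zeta> = 1 / real (card (S - \<eta>) choose card (\<zeta> - \<eta>))" for \<zeta>
  \<comment> \<open>Condition on the first element \<open>k\<close> added to \<open>\<eta>\<close>:
    it is uniform on \<open>S - \<eta>\<close>, and the chain can still reach \<open>\<zeta>\<close>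
    only if \<open>k\<close> lies in \<open>\<zeta>\<close>.\<close>
  have avg: "f \<zeta> = (\<Sum>k\<in>\<zeta> - \<eta>. 1 / real (card (S - insert k \<eta>) choose card (\<zeta> - insert k \<eta>))) / Suc m"
    if "\<zeta> \<in> \<A>" "\<eta> \<subset> \<zeta>" for \<zeta>
  proof -
    have sub: "\<zeta> - \<eta> \<subseteq> S - \<eta>" using that A by auto
    then have fz: "finite (\<zeta> - \<eta>)" using fin by (rule finite_subset)
    have "0 < card (\<zeta> - \<eta>)" using that fz by (auto simp: card_gt_0_iff)
    moreover have "card (\<zeta> - \<eta>) \<le> card (S - \<eta>)" using sub fin by (rule card_mono[rotated])
    ultimately have "f \<zeta> = real (card (\<zeta> - \<eta>)) / real (card (S - \<eta>)) *
        (1 / real ((card (S - \<eta>) - 1) choose (card (\<zeta> - \<eta>) - 1)))"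
      unfolding f_def by (rule inverse_binomial_eq_average)
    moreover have "card (S - insert k \<eta>) = card (S - \<eta>) - 1 \<and> card (\<zeta> - insert k \<eta>) = card (\<zeta> - \<eta>) - 1"
      if "k \<in> \<zeta> - \<eta>" for k
    proof -
      have "S - insert k \<eta> = S - \<eta> - {k}" "\<zeta> - insert k \<eta> = \<zeta> - \<eta> - {k}" by blast+
      moreover have "k \<in> S - \<eta>" using that sub by blast
      ultimately show ?thesis using that by (metis card_Diff_singleton)
    qed
    ultimately show ?thesis by (simp add: m)
  qed
  have "(\<Sum>\<zeta> | \<zeta> \<in> \<A> \<and> \<eta> \<subset> \<zeta>. f \<zeta>) =
      (\<Sum>\<zeta> | \<zeta> \<in> \<A> \<and> \<eta> \<subset> \<zeta>. \<Sum>k | k \<in> S - \<eta> \<and> k \<in> \<zeta>.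
         1 / real (card (S - insert k \<eta>) choose card (\<zeta> - insert k \<eta>))) / Suc m"
    unfolding sum_divide_distrib
  proof (rule sum.cong[OF refl])
    fix \<zeta> assume "\<zeta> \<in> {\<zeta>. \<zeta> \<in> \<A> \<and> \<eta> \<subset> \<zeta>}"
    moreover from this have "{k. k \<in> S - \<eta> \<and> k \<in> \<zeta>} = \<zeta> - \<eta>" using A by auto
    ultimately show "f \<zeta> = (\<Sum>k | k \<in> S - \<eta> \<and> k \<in> \<zeta>.
         1 / real (card (S - insert k \<eta>) choose card (\<zeta> - insert k \<eta>)) / real (Suc m))"
      using avg[of \<zeta>] by (simp add: sum_divide_distrib)
  qed
  also have "(\<Sum>\<zeta> | \<zeta> \<in> \<A> \<and> \<eta> \<subset> \<zeta>. \<Sum>k | k \<in> S - \<eta> \<and> k \<in> \<zeta>.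
         1 / real (card (S - insert k \<eta>) choose card (\<zeta> - insert k \<eta>))) =
      (\<Sum>k\<in>S - \<eta>. \<Sum>\<zeta> | \<zeta> \<in> {\<zeta>. \<zeta> \<in> \<A> \<and> \<eta> \<subset> \<zeta>} \<and> k \<in> \<zeta>.
         1 / real (card (S - insert k \<eta>) choose card (\<zeta> - insert k \<eta>)))"
    using finA fin by (intro sum.swap_restrict) auto
  also have "\<dots> = (\<Sum>k\<in>S - \<eta>. ?V (insert k \<eta>))"
    by (intro sum.cong refl) auto
  finally have step: "(\<Sum>\<zeta> | \<zeta> \<in> \<A> \<and> \<eta> \<subset> \<zeta>. f \<zeta>) = (\<Sum>k\<in>S - \<eta>. ?V (insert k \<eta>)) / Suc m" .
  show ?case
  proof (cases "\<eta> \<in> \<A>")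
    case False
    then have "{\<zeta>. \<zeta> \<in> \<A> \<and> \<eta> \<subseteq> \<zeta>} = {\<zeta>. \<zeta> \<in> \<A> \<and> \<eta> \<subset> \<zeta>}" by auto
    then have "?V \<eta> = (\<Sum>k\<in>S - \<eta>. ?V (insert k \<eta>)) / Suc m"
      using step by (simp add: f_def)
    also have "\<dots> \<le> (real (card (S - \<eta>)) * (1 / \<kappa>)) / Suc m"
      using IH by (intro divide_right_mono sum_bounded_above) auto
    also have "\<dots> = 1 / \<kappa>" by (simp add: m)
    finally show ?thesis .
  next
    case True
    note B\<eta> = B(1)[OF True] B(2)[OF True]
    have "{\<zeta>. \<zeta> \<in> \<A> \<and> \<eta> \<subseteq> \<zeta>} = insert \<eta> {\<zeta>. \<zeta> \<in> \<A> \<and> \<eta> \<subset> \<zeta>}" using True by auto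
    then have "?V \<eta> = f \<eta> + (\<Sum>\<zeta> | \<zeta> \<in> \<A> \<and> \<eta> \<subset> \<zeta>. f \<zeta>)"
      using finA by (simp add: f_def)
    also have "\<dots> = 1 + (\<Sum>k\<in>S - \<eta>. ?V (insert k \<eta>)) / Suc m"
      by (simp add: step) (simp add: f_def)
    \<comment> \<open>First steps into \<open>B \<eta>\<close> contribute nothing, since no member
      above \<open>\<eta>\<close> meets that set.\<close>
    also have "(\<Sum>k\<in>S - \<eta>. ?V (insert k \<eta>)) = (\<Sum>k\<in>S - \<eta> - B \<eta>. ?V (insert k \<eta>))"
    proof (rule sum.mono_neutral_right)
      show "\<forall>k\<in>S - \<eta> - (S - \<eta> - B \<eta>). ?V (insert k \<eta>) = 0"
      proof
        fix k assume "k \<in> S - \<eta> - (S - \<eta> - B \<eta>)"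
        then have "{\<zeta>. \<zeta> \<in> \<A> \<and> insert k \<eta> \<subseteq> \<zeta>} = {}"
          using B(3)[OF True] by auto
        then show "?V (insert k \<eta>) = 0" by (simp only: sum.empty)
      qed
    qed (use fin in auto)
    also have "\<dots> \<le> real (card (S - \<eta> - B \<eta>)) * (1 / \<kappa>)"
      using IH by (intro sum_bounded_above) auto
    also have "real (card (S - \<eta> - B \<eta>)) = real (card (S - \<eta>)) - real (card (B \<eta>))"
      using B\<eta>(1) fin by (metis card_Diff_subset card_mono finite_subset of_nat_diff)
    also have "\<dots> * (1 / \<kappa>) \<le> ((1 - \<kappa>) * real (Suc m)) * (1 / \<kappa>)"
      using B\<eta>(2) \<kappa> unfolding m by (intro mult_right_mono) (auto simp: algebra_simps)
    finally have "?V \<eta> \<le> 1 + ((1 - \<kappa>) * real (Suc m)) * (1 / \<kappa>) / Suc m"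
      by (simp add: divide_right_mono)
    \<comment> \<open>The bound reproduces itself because \<open>1 / \<kappa>\<close> is the fixed
      point of \<open>t = 1 + (1 - \<kappa>) * t\<close>.\<close>
    also have "\<dots> = 1 + (1 - \<kappa>) * (1 / \<kappa>)" by (simp del: of_nat_Suc)
    also have "\<dots> = 1 / \<kappa>" using \<kappa> by (simp add: field_simps)
    finally show ?thesis .
  qed
qed

section \<open>Randomising the start of the chain\<close>

text \<open>Both sides arise by integrating \<open>\<Prod>k\<in>S. 1 - r k + r k * s \<le> (1 - \<beta> + \<beta> * s) ^ card S\<close> over
  \<open>s \<in> [0, 1]\<close>; instead of integrals, the proof compares antiderivatives.\<close>

lemma expectation_inverse_Suc_card:
  fixes r :: "'a \<Rightarrow> real"
  assumes S: "finite S" and \<beta>: "0 < \<beta>" and r: "\<And>k. k \<in> S \<Longrightarrow> \<beta> \<le> r k \<and> r k \<le> 1"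
    and \<beta>1: "\<beta> \<le> 1"
  shows "(\<Sum>T\<in>Pow S. (\<Prod>k\<in>T. 1 - r k) * (\<Prod>k\<in>S - T. r k) / real (Suc (card (S - T))))
    \<le> 1 / (real (Suc (card S)) * \<beta>)"
proof -
  \<comment> \<open>\<open>w T\<close> is the probability of drawing \<open>T\<close> when each
    \<open>k\<close> enters independently with probability \<open>1 - r k\<close>. The derivative of
    \<open>g\<close> is the generating function of the number of elements left out.\<close>
  define w where "w T = (\<Prod>k\<in>T. 1 - r k) * (\<Prod>k\<in>S - T. r k)" for T
  define g where "g s = (\<Sum>T\<in>Pow S. w T / real (Suc (card (S - T))) * s ^ Suc (card (S - T)))" for s
  define h where "h s = (1 - \<beta> + \<beta> * s) ^ Suc (card S) / (real (Suc (card S)) * \<beta>)" for s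
  have "h 0 - g 0 \<le> h 1 - g 1"
  proof (rule DERIV_nonneg_imp_nondecreasing[where f = "\<lambda>s. h s - g s"])
    fix s :: real assume s: "0 \<le> s" "s \<le> 1"
    have "(h has_real_derivative (1 - \<beta> + \<beta> * s) ^ card S) (at s)"
      unfolding h_def using \<beta>
      by (auto intro!: derivative_eq_intros simp del: power_Suc of_nat_Suc)
    moreover have "(g has_real_derivative (\<Sum>T\<in>Pow S. w T * s ^ card (S - T))) (at s)"
      unfolding g_def
      by (auto intro!: derivative_eq_intros sum.cong simp del: power_Suc of_nat_Suc)
    moreover have "(\<Sum>T\<in>Pow S. w T * s ^ card (S - T)) = (\<Prod>k\<in>S. (1 - r k) + r k * s)"
      unfolding w_def prod_add[OF S] by (simp add: prod.distrib mult.assoc)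
    moreover have "(\<Prod>k\<in>S. (1 - r k) + r k * s) \<le> (1 - \<beta> + \<beta> * s) ^ card S"
      unfolding prod_constant[symmetric]
    proof (rule prod_mono)
      \<comment> \<open>The two factors differ by exactly
        \<open>(r k - \<beta>) * (1 - s)\<close>.\<close>
      fix k assume "k \<in> S"
      then have "0 \<le> r k * s" "(r k - \<beta>) * (1 - s) \<ge> 0" "r k \<le> 1"
        using r[of k] s \<beta> by auto
      then show "0 \<le> (1 - r k) + r k * s \<and> (1 - r k) + r k * s \<le> 1 - \<beta> + \<beta> * s"
        by (simp add: algebra_simps)
    qed
    ultimately show "\<exists>y. ((\<lambda>s. h s - g s) has_real_derivative y) (at s) \<and> 0 \<le> y"
      by (metis DERIV_diff diff_ge_0_iff_ge)
  qed simp
  moreover have "h 0 \<ge> 0" "g 0 = 0" using \<beta> \<beta>1 by (simp_all add: h_def g_def)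
  ultimately have "g 1 \<le> h 1" by linarith
  then show ?thesis by (simp add: g_def h_def w_def)
qed

section \<open>Point masses of a product distribution\<close>

text \<open>A singleton is the intersection of the events fixing each coordinate, so independence
  factorises its measure. \<open>N \<ge> 1\<close> keeps the index set nonempty; an empty
  intersection would be \<open>UNIV\<close>.\<close>

lemma product_distribution_measure_singleton:
  assumes N: "N \<ge> 1" and \<mu>: "product_distribution N \<mu>" and \<zeta>: "\<zeta> \<subseteq> {1..N}"
  shows "measure \<mu> {\<zeta>} = (\<Prod>k\<in>\<zeta>. marginal \<mu> k) * (\<Prod>k\<in>{1..N} - \<zeta>. 1 - marginal \<mu> k)"
proof -
  interpret prob_space \<mu> using \<mu> by (simp add: product_distribution_def)
  have sp: "space \<mu> = Pow {1..N}" and sets: "sets \<mu> = Pow (Pow {1..N})"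
    and ind: "indep_vars (\<lambda>_. count_space UNIV) coord {1..N}"
    using \<mu> by (auto simp: product_distribution_def)
  let ?E = "\<lambda>k. coord k -` {coord k \<zeta>} \<inter> space \<mu>"
  have "{\<zeta>} = (\<Inter>k\<in>{1..N}. ?E k)"
  proof (intro set_eqI iffI)
    fix \<xi> assume "\<xi> \<in> (\<Inter>k\<in>{1..N}. ?E k)"
    then have "\<forall>k\<in>{1..N}. \<xi> \<subseteq> {1..N} \<and> (k \<in> \<xi> \<longleftrightarrow> k \<in> \<zeta>)"
      by (auto simp: sp coord_def split: if_splits)
    moreover have "1 \<in> {1..N}" using N by simp
    ultimately have "\<xi> \<subseteq> {1..N}" "\<forall>k\<in>{1..N}. k \<in> \<xi> \<longleftrightarrow> k \<in> \<zeta>" by blast+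
    with \<zeta> show "\<xi> \<in> {\<zeta>}" by blast
  qed (use \<zeta> in \<open>simp add: sp\<close>)
  then have "measure \<mu> {\<zeta>} = (\<Prod>k\<in>{1..N}. measure \<mu> (?E k))"
    using indep_varsD[OF ind, of "{1..N}" "\<lambda>k. {coord k \<zeta>}"] N by simp
  also have "\<dots> = (\<Prod>k\<in>{1..N}. if k \<in> \<zeta> then marginal \<mu> k else 1 - marginal \<mu> k)"
  proof (rule prod.cong[OF refl])
    fix k
    have "{\<xi> \<in> space \<mu>. coord k \<xi> = 1} \<in> events" by (auto simp: sets sp)
    from prob_compl[OF this]
    have "prob (space \<mu> - {\<xi> \<in> space \<mu>. coord k \<xi> = 1}) = 1 - marginal \<mu> k"
      by (simp add: marginal_def)
    moreover have "?E k = (if k \<in> \<zeta> then {\<xi> \<in> space \<mu>. coord k \<xi> = 1}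
        else space \<mu> - {\<xi> \<in> space \<mu>. coord k \<xi> = 1})"
      by (auto simp: coord_def split: if_splits)
    ultimately show "prob (?E k) = (if k \<in> \<zeta> then marginal \<mu> k else 1 - marginal \<mu> k)"
      by (simp add: marginal_def)
  qed
  also have "\<dots> = (\<Prod>k\<in>\<zeta>. marginal \<mu> k) * (\<Prod>k\<in>{1..N} - \<zeta>. 1 - marginal \<mu> k)"
    using \<zeta> by (simp add: prod.If_cases Int_absorb1 Diff_eq)
  finally show ?thesis .
qed

section \<open>The bound for product weights\<close>

text \<open>Each summand is a binomial weight for the number of added elements times the probability
  that a random chain from \<open>\<eta>\<close> meets \<open>\<zeta>\<close>. The former is bounded
  uniformly, and the latter sum to at most \<open>1 / \<kappa>\<close>.\<close>

lemma kappa_sperner_interval_bound: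
  fixes S :: "'a set" and \<kappa> q :: real
  assumes S: "finite S" and \<kappa>: "0 < \<kappa>" "\<kappa> \<le> 1" and A: "\<A> \<subseteq> Pow S"
    and B: "\<And>\<zeta>. \<zeta> \<in> \<A> \<Longrightarrow> B \<zeta> \<subseteq> S - \<zeta>"
      "\<And>\<zeta>. \<zeta> \<in> \<A> \<Longrightarrow> \<kappa> * real (card (S - \<zeta>)) \<le> real (card (B \<zeta>))"
      "\<And>\<zeta> \<zeta>'. \<zeta> \<in> \<A> \<Longrightarrow> \<zeta>' \<in> \<A> \<Longrightarrow> \<zeta> \<subseteq> \<zeta>' \<Longrightarrow> \<zeta>' \<inter> B \<zeta> = {}"
    and \<eta>: "\<eta> \<subseteq> S" and q: "0 < q" "q < 1"
  shows "(\<Sum>\<zeta> | \<zeta> \<in> \<A> \<and> \<eta> \<subseteq> \<zeta>. q ^ card (\<zeta> - \<eta>) * (1 - q) ^ card (S - \<zeta>))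
    \<le> 1 / sqrt (real (Suc (card (S - \<eta>))) * q * (1 - q)) * (1 / \<kappa>)"
proof -
  let ?c = "1 / sqrt (real (Suc (card (S - \<eta>))) * q * (1 - q))"
  have "(\<Sum>\<zeta> | \<zeta> \<in> \<A> \<and> \<eta> \<subseteq> \<zeta>. q ^ card (\<zeta> - \<eta>) * (1 - q) ^ card (S - \<zeta>))
    \<le> (\<Sum>\<zeta> | \<zeta> \<in> \<A> \<and> \<eta> \<subseteq> \<zeta>. ?c * (1 / real (card (S - \<eta>) choose card (\<zeta> - \<eta>))))"
  proof (rule sum_mono)
    fix \<zeta> assume \<zeta>: "\<zeta> \<in> {\<zeta>. \<zeta> \<in> \<A> \<and> \<eta> \<subseteq> \<zeta>}"
    then have sub: "\<zeta> - \<eta> \<subseteq> S - \<eta>" and eq: "S - \<zeta> = (S - \<eta>) - (\<zeta> - \<eta>)" using A by auto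
    have le: "card (\<zeta> - \<eta>) \<le> card (S - \<eta>)" using sub S by (simp add: card_mono)
    have "card (S - \<zeta>) = card (S - \<eta>) - card (\<zeta> - \<eta>)"
      unfolding eq using sub S by (meson card_Diff_subset finite_Diff finite_subset)
    moreover have "real (card (S - \<eta>) choose card (\<zeta> - \<eta>)) > 0" using le by simp
    ultimately have "q ^ card (\<zeta> - \<eta>) * (1 - q) ^ card (S - \<zeta>) =
        Bernstein (card (S - \<eta>)) (card (\<zeta> - \<eta>)) q * (1 / real (card (S - \<eta>) choose card (\<zeta> - \<eta>)))"
      by (simp add: Bernstein_def)
    also have "\<dots> \<le> ?c * (1 / real (card (S - \<eta>) choose card (\<zeta> - \<eta>)))"
      by (intro mult_right_mono Bernstein_le_inverse_sqrt q le) simp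
    finally show "q ^ card (\<zeta> - \<eta>) * (1 - q) ^ card (S - \<zeta>)
        \<le> ?c * (1 / real (card (S - \<eta>) choose card (\<zeta> - \<eta>)))" .
  qed
  also have "\<dots> \<le> ?c * (1 / \<kappa>)"
    unfolding sum_distrib_left[symmetric]
    using q by (intro mult_left_mono LYM_kappa_sperner[OF S \<kappa> A B \<eta>]) auto
  finally show ?thesis .
qed

text \<open>Conditioning on the random start \<open>T\<close> reduces the claim to
  \<open>kappa_sperner_interval_bound\<close>; the remaining average over \<open>T\<close> is
  controlled by \<open>expectation_inverse_Suc_card\<close>.\<close>

lemma kappa_sperner_product_bound:
  fixes S :: "'a set" and \<kappa> \<beta> :: real
  assumes S: "finite S" and \<kappa>: "0 < \<kappa>" "\<kappa> \<le> 1" and A: "\<A> \<subseteq> Pow S"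
    and B: "\<And>\<zeta>. \<zeta> \<in> \<A> \<Longrightarrow> B \<zeta> \<subseteq> S - \<zeta>"
      "\<And>\<zeta>. \<zeta> \<in> \<A> \<Longrightarrow> \<kappa> * real (card (S - \<zeta>)) \<le> real (card (B \<zeta>))"
      "\<And>\<zeta> \<zeta>'. \<zeta> \<in> \<A> \<Longrightarrow> \<zeta>' \<in> \<A> \<Longrightarrow> \<zeta> \<subseteq> \<zeta>' \<Longrightarrow> \<zeta>' \<inter> B \<zeta> = {}"
    and \<beta>: "0 < \<beta>" "\<beta> < 1" and p: "\<And>k. k \<in> S \<Longrightarrow> \<beta> \<le> p k \<and> p k \<le> 1 - \<beta>"
  shows "(\<Sum>\<zeta>\<in>\<A>. (\<Prod>k\<in>\<zeta>. p k) * (\<Prod>k\<in>S - \<zeta>. 1 - p k))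
    \<le> 1 / (\<kappa> * \<beta> * sqrt (real (Suc (card S)) * (1 - \<beta>)))"
proof -
  \<comment> \<open>Chosen so that \<open>1 - p k = r k * (1 - \<beta>)\<close>: an element is
    absent if it is outside \<open>T\<close>, with probability \<open>r k\<close>, and is then not
    added.\<close>
  define r where "r k = (1 - p k) / (1 - \<beta>)" for k
  have r: "\<beta> \<le> r k \<and> r k \<le> 1" if "k \<in> S" for k
  proof -
    have "\<beta> * (1 - \<beta>) \<le> \<beta>" using \<beta> by (simp add: algebra_simps)
    then have "\<beta> * (1 - \<beta>) \<le> 1 - p k" using p[OF that] by linarith
    then show ?thesis
      using p[OF that] \<beta> by (simp add: r_def pos_le_divide_eq pos_divide_le_eq)
  qed
  have p_eq: "p k = (1 - r k) + r k * \<beta>" "1 - p k = r k * (1 - \<beta>)" for k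
    using \<beta> by (simp_all add: r_def divide_simps) (simp add: algebra_simps)
  define w where "w T = (\<Prod>k\<in>T. 1 - r k) * (\<Prod>k\<in>S - T. r k)" for T
  have w_nonneg: "w T \<ge> 0" if "T \<subseteq> S" for T
  proof -
    have "0 \<le> 1 - r k" "0 \<le> r k" if "k \<in> S" for k using r[OF that] \<beta> by auto
    with that show ?thesis unfolding w_def by (intro mult_nonneg_nonneg prod_nonneg) auto
  qed
  have w_sum: "(\<Sum>T\<in>Pow S. w T) = 1"
    using prod_add[OF S, of "\<lambda>k. 1 - r k" r] by (simp add: w_def)
  have finA: "finite \<A>" using A S by (meson finite_Pow_iff finite_subset)
  \<comment> \<open>Total probability over the start \<open>T\<close>: elements of
    \<open>\<zeta> - T\<close> are added with probability \<open>\<beta>\<close>, those of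
    \<open>S - \<zeta>\<close> are rejected.\<close>
  have mix: "(\<Prod>k\<in>\<zeta>. p k) * (\<Prod>k\<in>S - \<zeta>. 1 - p k) =
      (\<Sum>T | T \<in> Pow S \<and> T \<subseteq> \<zeta>. w T * (\<beta> ^ card (\<zeta> - T) * (1 - \<beta>) ^ card (S - \<zeta>)))"
    if "\<zeta> \<in> \<A>" for \<zeta>
  proof -
    have sub: "\<zeta> \<subseteq> S" using that A by auto
    then have fin: "finite \<zeta>" using S by (rule finite_subset)
    have T: "(\<Prod>k\<in>T. 1 - r k) * (\<Prod>k\<in>\<zeta> - T. r k * \<beta>) * (\<Prod>k\<in>S - \<zeta>. r k * (1 - \<beta>)) =
        w T * (\<beta> ^ card (\<zeta> - T) * (1 - \<beta>) ^ card (S - \<zeta>))" if "T \<subseteq> \<zeta>" for T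
    proof -
      have "S - T = (\<zeta> - T) \<union> (S - \<zeta>)" using that sub by auto
      then have "(\<Prod>k\<in>S - T. r k) = (\<Prod>k\<in>\<zeta> - T. r k) * (\<Prod>k\<in>S - \<zeta>. r k)"
        using S fin prod.union_disjoint[of "\<zeta> - T" "S - \<zeta>" r] by auto
      then show ?thesis by (simp add: w_def prod.distrib)
    qed
    have "(\<Prod>k\<in>\<zeta>. p k) * (\<Prod>k\<in>S - \<zeta>. 1 - p k) =
        (\<Sum>T\<in>Pow \<zeta>. (\<Prod>k\<in>T. 1 - r k) * (\<Prod>k\<in>\<zeta> - T. r k * \<beta>)) * (\<Prod>k\<in>S - \<zeta>. r k * (1 - \<beta>))"
      unfolding p_eq(2) prod_add[OF fin, symmetric] p_eq(1)[symmetric] ..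
    also have "\<dots> = (\<Sum>T\<in>Pow \<zeta>. w T * (\<beta> ^ card (\<zeta> - T) * (1 - \<beta>) ^ card (S - \<zeta>)))"
      unfolding sum_distrib_right by (intro sum.cong refl T) auto
    also have "Pow \<zeta> = {T. T \<in> Pow S \<and> T \<subseteq> \<zeta>}" using sub by auto
    finally show ?thesis .
  qed
  \<comment> \<open>\<open>1 / a\<close> bounds the mean of \<open>1 / Suc (card (S - T))\<close>.
    The inequality \<open>amgm\<close> is the tangent to the square root of \<open>1 / x\<close> at
    \<open>x = a\<close>; it plays the part of Jensen's inequality and makes the average linear in
    \<open>1 / x\<close>.\<close>
  define a where "a = real (Suc (card S)) * \<beta>"
  have a: "a > 0" using \<beta> by (simp add: a_def)
  have amgm: "1 / sqrt x \<le> (sqrt a * (1 / x) + 1 / sqrt a) / 2" if "x > 0" for x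
  proof -
    define u where "u = sqrt a"
    define v where "v = sqrt x"
    have uv: "u > 0" "v > 0" "x = v\<^sup>2" using a that by (auto simp: u_def v_def)
    have "0 \<le> (1 / v - 1 / u)\<^sup>2 * u" using uv by simp
    also have "\<dots> = sqrt a * (1 / x) + 1 / sqrt a - 2 * (1 / sqrt x)"
      unfolding u_def[symmetric] v_def[symmetric] uv(3)
      using uv(1,2) by (simp add: power2_eq_square field_simps)
    finally have "1 / sqrt x * 2 \<le> sqrt a * (1 / x) + 1 / sqrt a"
      by (simp only: diff_ge_0_iff_ge mult.commute)
    then show ?thesis by (simp only: pos_le_divide_eq zero_less_numeral)
  qed
  have "(\<Sum>\<zeta>\<in>\<A>. (\<Prod>k\<in>\<zeta>. p k) * (\<Prod>k\<in>S - \<zeta>. 1 - p k)) =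
      (\<Sum>\<zeta>\<in>\<A>. \<Sum>T | T \<in> Pow S \<and> T \<subseteq> \<zeta>. w T * (\<beta> ^ card (\<zeta> - T) * (1 - \<beta>) ^ card (S - \<zeta>)))"
    by (intro sum.cong refl mix)
  also have "\<dots> = (\<Sum>T\<in>Pow S. w T *
      (\<Sum>\<zeta> | \<zeta> \<in> \<A> \<and> T \<subseteq> \<zeta>. \<beta> ^ card (\<zeta> - T) * (1 - \<beta>) ^ card (S - \<zeta>)))"
    unfolding sum_distrib_left using finA S by (intro sum.swap_restrict) auto
  also have "\<dots> \<le> (\<Sum>T\<in>Pow S. w T * ((sqrt a * (1 / real (Suc (card (S - T)))) + 1 / sqrt a) / 2
      * (1 / (\<kappa> * sqrt (\<beta> * (1 - \<beta>))))))"
  proof (intro sum_mono mult_left_mono)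
    fix T assume "T \<in> Pow S"
    then have "T \<subseteq> S" by simp
    then show "w T \<ge> 0" by (rule w_nonneg)
    have "(\<Sum>\<zeta> | \<zeta> \<in> \<A> \<and> T \<subseteq> \<zeta>. \<beta> ^ card (\<zeta> - T) * (1 - \<beta>) ^ card (S - \<zeta>))
        \<le> 1 / sqrt (real (Suc (card (S - T))) * \<beta> * (1 - \<beta>)) * (1 / \<kappa>)"
      by (rule kappa_sperner_interval_bound[OF S \<kappa> A B \<open>T \<subseteq> S\<close> \<beta>])
    also have "\<dots> = 1 / sqrt (real (Suc (card (S - T)))) * (1 / (\<kappa> * sqrt (\<beta> * (1 - \<beta>))))"
      by (simp add: real_sqrt_mult mult.assoc mult.commute del: of_nat_Suc)
    also have "\<dots> \<le> (sqrt a * (1 / real (Suc (card (S - T)))) + 1 / sqrt a) / 2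
        * (1 / (\<kappa> * sqrt (\<beta> * (1 - \<beta>))))"
      using \<kappa> \<beta> by (intro mult_right_mono amgm) auto
    finally show "(\<Sum>\<zeta> | \<zeta> \<in> \<A> \<and> T \<subseteq> \<zeta>. \<beta> ^ card (\<zeta> - T) * (1 - \<beta>) ^ card (S - \<zeta>))
        \<le> (sqrt a * (1 / real (Suc (card (S - T)))) + 1 / sqrt a) / 2
        * (1 / (\<kappa> * sqrt (\<beta> * (1 - \<beta>))))" .
  qed
  also have "\<dots> = (sqrt a * (\<Sum>T\<in>Pow S. w T / real (Suc (card (S - T)))) + 1 / sqrt a * (\<Sum>T\<in>Pow S. w T)) / 2
      * (1 / (\<kappa> * sqrt (\<beta> * (1 - \<beta>))))"
    by (simp add: sum_distrib_left sum_distrib_right sum_divide_distrib sum.distrib[symmetric]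
        algebra_simps add_divide_distrib del: of_nat_Suc)
  \<comment> \<open>By the choice of \<open>a\<close> both terms in the bracket become
    \<open>1 / sqrt a\<close>.\<close>
  also have "\<dots> \<le> (sqrt a * (1 / a) + 1 / sqrt a * 1) / 2 * (1 / (\<kappa> * sqrt (\<beta> * (1 - \<beta>))))"
    unfolding w_sum
    using expectation_inverse_Suc_card[OF S \<beta>(1) r] \<kappa> \<beta> a
    by (intro mult_right_mono divide_right_mono add_right_mono mult_left_mono)
      (auto simp: w_def a_def simp del: of_nat_Suc)
  also have "sqrt a * (1 / a) = 1 / sqrt a"
    using a by (simp add: real_div_sqrt field_simps)
  also have "(1 / sqrt a + 1 / sqrt a * 1) / 2 * (1 / (\<kappa> * sqrt (\<beta> * (1 - \<beta>)))) =
      1 / (\<kappa> * (sqrt \<beta> * sqrt \<beta>) * sqrt (real (Suc (card S)) * (1 - \<beta>)))"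
    by (simp add: a_def real_sqrt_mult mult_ac del: of_nat_Suc real_sqrt_mult_self)
  finally show ?thesis using \<beta> by simp
qed

theorem lemma4p9:
  fixes \<beta> :: real
  assumes "\<beta> > 0"
  shows "\<exists>C::real. \<forall>(N::nat) (\<mu> :: nat set measure) (\<kappa>::real) (\<A> :: nat set set).
           N \<ge> 1 \<longrightarrow>
           product_distribution N \<mu> \<longrightarrow>
           nontrivial_distribution N \<mu> \<longrightarrow>
           (\<forall>k\<in>{1..N}. \<beta> \<le> min (marginal \<mu> k) (1 - marginal \<mu> k)) \<longrightarrow>
           0 < \<kappa> \<longrightarrow> \<kappa> \<le> 1 \<longrightarrow>
           sperner_family \<kappa> N \<A> \<longrightarrow>
           measure \<mu> \<A> \<le> C / (\<kappa> * sqrt (real N))"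
proof -
  \<comment> \<open>The factor \<open>sqrt 2\<close> comes from
    \<open>1 - \<beta> \<ge> 1 / 2\<close>, which holds because some coordinate exists and both of
    its probabilities are at least \<open>\<beta>\<close>.\<close>
  have "measure \<mu> \<A> \<le> (sqrt 2 / \<beta>) / (\<kappa> * sqrt (real N))"
    if N: "N \<ge> 1" and \<mu>: "product_distribution N \<mu>"
      and p: "\<forall>k\<in>{1..N}. \<beta> \<le> min (marginal \<mu> k) (1 - marginal \<mu> k)"
      and \<kappa>: "0 < \<kappa>" "\<kappa> \<le> 1" and A: "sperner_family \<kappa> N \<A>"
    for N \<mu> \<kappa> \<A>
  proof -
    have sets: "sets \<mu> = Pow (Pow {1..N})" and "prob_space \<mu>"
      using \<mu> by (auto simp: product_distribution_def)
    then interpret prob_space \<mu> by simp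
    have sub: "\<A> \<subseteq> Pow {1..N}" using A by (simp add: sperner_family_def)
    obtain B where B: "\<And>\<zeta>. \<zeta> \<in> \<A> \<Longrightarrow> B \<zeta> \<subseteq> {1..N} - \<zeta>"
      "\<And>\<zeta>. \<zeta> \<in> \<A> \<Longrightarrow> \<kappa> * real (card ({1..N} - \<zeta>)) \<le> real (card (B \<zeta>))"
      "\<And>\<zeta> \<zeta>'. \<zeta> \<in> \<A> \<Longrightarrow> \<zeta>' \<in> \<A> \<Longrightarrow> \<zeta> \<subseteq> \<zeta>' \<Longrightarrow> \<zeta>' \<inter> B \<zeta> = {}"
      using A unfolding sperner_family_def by metis
    have "1 \<in> {1..N}" using N by simp
    then have half: "\<beta> \<le> 1 / 2" using p by fastforce
    have p': "\<beta> \<le> marginal \<mu> k \<and> marginal \<mu> k \<le> 1 - \<beta>" if "k \<in> {1..N}" for k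
      using p that by fastforce
    have "finite \<A>" using sub by (meson finite_Pow_iff finite_atLeastAtMost finite_subset)
    then have "measure \<mu> \<A> = (\<Sum>\<zeta>\<in>\<A>. measure \<mu> {\<zeta>})"
      using sub by (intro finite_measure_eq_sum_singleton) (auto simp: sets)
    also have "\<dots> = (\<Sum>\<zeta>\<in>\<A>. (\<Prod>k\<in>\<zeta>. marginal \<mu> k) * (\<Prod>k\<in>{1..N} - \<zeta>. 1 - marginal \<mu> k))"
      using sub by (intro sum.cong refl product_distribution_measure_singleton[OF N \<mu>]) auto
    also have "\<dots> \<le> 1 / (\<kappa> * \<beta> * sqrt (real (Suc (card {1..N})) * (1 - \<beta>)))"
      using half assms by (intro kappa_sperner_product_bound[OF _ \<kappa> sub B]) (auto simp: p')
    also have "\<dots> \<le> 1 / (\<kappa> * \<beta> * sqrt (real N / 2))"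
    proof -
      have "real N * (1 / 2) \<le> real (Suc (card {1..N})) * (1 - \<beta>)"
        using half by (intro mult_mono) auto
      then show ?thesis
        using N \<kappa> assms by (intro divide_left_mono mult_left_mono real_sqrt_le_mono) auto
    qed
    also have "\<dots> = (sqrt 2 / \<beta>) / (\<kappa> * sqrt (real N))"
      by (simp add: real_sqrt_divide)
    finally show ?thesis .
  qed
  then show ?thesis by (intro exI[of _ "sqrt 2 / \<beta>"]) blast
qed

end
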